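(* On the symmetric monoidal category $(\mathbf{Srel}_{fn},\otimes,I)$ of finite stochastic relations, for $f:X\otimes U\to Y\otimes U$ define $\mathrm{Tr}^U_{X,Y}(f)$ to be defined if and only if $$\sum_{y\in Y}\sum_{u\in U}f(y,u,x,u)\le 1\quad\text{for all }x\in X,$$ and in that case let $\mathrm{Tr}^U_{X,Y}(f):X\to Y$ be given by $\mathrm{Tr}^U_{X,Y}(f)(y,x)=\sum_{u\in U}f(y,u,x,u)$. Then $\mathrm{Tr}$ is a partial trace on $\mathbf{Srel}_{fn}$.
   Context: $\mathbf{Srel}_{fn}$: objects are finite sets; a morphism $f:A\to B$ is a matrix $f:B\times A\to[0,1]$ with $\sum_{b\in B}f(b,a)\le1$ for all $a\in A$; composition is $(g\circ f)(c,a)=\sum_{b}g(c,b)f(b,a)$, identities are identity matrices. Tensor: $A\otimes B=A\times B$ on objects, and $(f\otimes g)(b,d,a,c)=f(b,a)g(d,c)$ for $f:A\to B$, $g:C\to D$; the unit is a one-point set and the structural isomorphisms (including the symmetry) are the 0/1-matrices of the corresponding bijections of the cartesian category of finite sets. For partially defined expressions, $a\simeq b$ (Kleene equality) means that $a,b$ are either both undefined, or both defined and equal; $a\lesssim b$ means that either $a$ is undefined, or both are defined and equal. A partial trace on a symmetric monoidal category $(\mathcal{C},\otimes,I,\rho,\lambda,\sigma)$ is a family of partial functions $\mathrm{Tr}^U_{X,Y}:\mathcal{C}(X\otimes U,Y\otimes U)\rightharpoonup\mathcal{C}(X,Y)$ satisfying (associativity isomorphisms suppressed): - Naturality: for $f:X\otimes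 U\to Y\otimes U$, $g:X'\to X$, $h:Y\to Y'$: $h\,\mathrm{Tr}^U_{X,Y}(f)\,g\lesssim \mathrm{Tr}^U_{X',Y'}((h\otimes 1_U)f(g\otimes 1_U))$. - Dinaturality: for $f:X\otimes U\to Y\otimes U'$, $g:U'\to U$: $\mathrm{Tr}^U_{X,Y}((1_Y\otimes g)f)\simeq \mathrm{Tr}^{U'}_{X,Y}(f(1_X\otimes g))$. - Vanishing I: for $f:X\otimes I\to Y\otimes I$: $\mathrm{Tr}^I_{X,Y}(f)\simeq\rho_Y f\rho_X^{-1}$, where $\rho_X:X\otimes I\to X$. - Vanishing II: for $g:X\otimes U\otimes V\to Y\otimes U\otimes V$, if $\mathrm{Tr}^V_{X\otimes U,Y\otimes U}(g)$ is defined then $\mathrm{Tr}^{U\otimes V}_{X,Y}(g)\simeq\mathrm{Tr}^U_{X,Y}(\mathrm{Tr}^V_{X\otimes U,Y\otimes U}(g))$. - Superposing: for $f:X\otimes U\to Y\otimes U$, $g:W\to Z$: $g\otimes\mathrm{Tr}^U_{X,Y}(f)\lesssim\mathrm{Tr}^U_{W\otimes X,Z\otimes Y}(g\otimes f)$. - Yanking: $\mathrm{Tr}^U_{U,U}(\sigma_{U,U})\simeq 1_U$. *)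

theory Defs
  imports Complex_Main
begin

record ('o, 'm) monoidal_structure =
  Obj :: "'o set"
  Arr :: "'m set"
  Dom :: "'m \<Rightarrow> 'o"
  Cod :: "'m \<Rightarrow> 'o"
  Ident :: "'o \<Rightarrow> 'm" ("\<one>\<index>")
  Comp :: "'m \<Rightarrow> 'm \<Rightarrow> 'm" (infixr "\<cdot>\<index>" 65)
  TensorO :: "'o \<Rightarrow> 'o \<Rightarrow> 'o" (infixr "\<otimes>\<index>" 75)
  TensorM :: "'m \<Rightarrow> 'm \<Rightarrow> 'm" (infixr "\<otimes>\<^sub>m\<index>" 75)
  UnitO :: "'o" ("\<I>\<index>")
  Assoc :: "'o \<Rightarrow> 'o \<Rightarrow> 'o \<Rightarrow> 'm" ("\<alpha>\<index>")
  LeftUnitor :: "'o \<Rightarrow> 'm" ("\<Lambda>\<index>")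
  RightUnitor :: "'o \<Rightarrow> 'm" ("\<rho>\<index>")
  Symmetry :: "'o \<Rightarrow> 'o \<Rightarrow> 'm" ("\<sigma>\<index>")

definition Hom :: "('o, 'm, 'z) monoidal_structure_scheme \<Rightarrow> 'o \<Rightarrow> 'o \<Rightarrow> 'm set" ("Hom\<index>") where
  "Hom\<^bsub>C\<^esub> A B = {f \<in> Arr C. Dom C f = A \<and> Cod C f = B}"

definition is_inverse :: "('o, 'm, 'z) monoidal_structure_scheme \<Rightarrow> 'm \<Rightarrow> 'm \<Rightarrow> bool" where
  "is_inverse C f g \<longleftrightarrow>
     g \<in> Hom\<^bsub>C\<^esub> (Cod C f) (Dom C f) \<and>
     g \<cdot>\<^bsub>C\<^esub> f = \<one>\<^bsub>C\<^esub> (Dom C f) \<and> f \<cdot>\<^bsub>C\<^esub> g = \<one>\<^bsub>C\<^esub> (Cod C f)"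

definition Isos :: "('o, 'm, 'z) monoidal_structure_scheme \<Rightarrow> 'o \<Rightarrow> 'o \<Rightarrow> 'm set" ("Isos\<index>") where
  "Isos\<^bsub>C\<^esub> A B = {f \<in> Hom\<^bsub>C\<^esub> A B. \<exists>g. is_inverse C f g}"

definition Inv :: "('o, 'm, 'z) monoidal_structure_scheme \<Rightarrow> 'm \<Rightarrow> 'm" ("Inv\<index> _" [81] 80) where
  "Inv\<^bsub>C\<^esub> f = (THE g. is_inverse C f g)"

locale category =
  fixes C :: "('o, 'm, 'z) monoidal_structure_scheme" (structure)
  assumes Dom_Obj: "f \<in> Arr C \<Longrightarrow> Dom C f \<in> Obj C"
    and Cod_Obj: "f \<in> Arr C \<Longrightarrow> Cod C f \<in> Obj C"
    and Id_Hom: "A \<in> Obj C \<Longrightarrow> \<one> A \<in> Hom A A"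
    and Comp_Hom: "\<lbrakk>f \<in> Hom A B; g \<in> Hom B D\<rbrakk> \<Longrightarrow> g \<cdot> f \<in> Hom A D"
    and Comp_Id: "f \<in> Hom A B \<Longrightarrow> f \<cdot> \<one> A = f"
    and Id_Comp: "f \<in> Hom A B \<Longrightarrow> \<one> B \<cdot> f = f"
    and Comp_assoc: "\<lbrakk>f \<in> Hom A B; g \<in> Hom B D; h \<in> Hom D E\<rbrakk> \<Longrightarrow> h \<cdot> (g \<cdot> f) = (h \<cdot> g) \<cdot> f"

locale symmetric_monoidal_category = category +
  assumes TensorO_Obj: "\<lbrakk>A \<in> Obj C; B \<in> Obj C\<rbrakk> \<Longrightarrow> A \<otimes> B \<in> Obj C"
    and UnitO_Obj: "\<I> \<in> Obj C"
    and TensorM_Hom: "\<lbrakk>f \<in> Hom A B; g \<in> Hom A' B'\<rbrakk> \<Longrightarrow> f \<otimes>\<^sub>m g \<in> Hom (A \<otimes> A') (B \<otimes> B')"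
    and TensorM_Id: "\<lbrakk>A \<in> Obj C; B \<in> Obj C\<rbrakk> \<Longrightarrow> \<one> A \<otimes>\<^sub>m \<one> B = \<one> (A \<otimes> B)"
    and TensorM_Comp: "\<lbrakk>f \<in> Hom A B; g \<in> Hom B D; f' \<in> Hom A' B'; g' \<in> Hom B' D'\<rbrakk>
      \<Longrightarrow> (g \<cdot> f) \<otimes>\<^sub>m (g' \<cdot> f') = (g \<otimes>\<^sub>m g') \<cdot> (f \<otimes>\<^sub>m f')"
    and Assoc_Isos: "\<lbrakk>A \<in> Obj C; B \<in> Obj C; D \<in> Obj C\<rbrakk>
      \<Longrightarrow> \<alpha> A B D \<in> Isos ((A \<otimes> B) \<otimes> D) (A \<otimes> (B \<otimes> D))"
    and Assoc_natural: "\<lbrakk>f \<in> Hom A A'; g \<in> Hom B B'; h \<in> Hom D D'\<rbrakk>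
      \<Longrightarrow> \<alpha> A' B' D' \<cdot> ((f \<otimes>\<^sub>m g) \<otimes>\<^sub>m h) = (f \<otimes>\<^sub>m (g \<otimes>\<^sub>m h)) \<cdot> \<alpha> A B D"
    and LeftUnitor_Isos: "A \<in> Obj C \<Longrightarrow> \<Lambda> A \<in> Isos (\<I> \<otimes> A) A"
    and LeftUnitor_natural: "f \<in> Hom A B \<Longrightarrow> \<Lambda> B \<cdot> (\<one> \<I> \<otimes>\<^sub>m f) = f \<cdot> \<Lambda> A"
    and RightUnitor_Isos: "A \<in> Obj C \<Longrightarrow> \<rho> A \<in> Isos (A \<otimes> \<I>) A"
    and RightUnitor_natural: "f \<in> Hom A B \<Longrightarrow> \<rho> B \<cdot> (f \<otimes>\<^sub>m \<one> \<I>) = f \<cdot> \<rho> A"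
    and Symmetry_Hom: "\<lbrakk>A \<in> Obj C; B \<in> Obj C\<rbrakk> \<Longrightarrow> \<sigma> A B \<in> Hom (A \<otimes> B) (B \<otimes> A)"
    and Symmetry_natural: "\<lbrakk>f \<in> Hom A A'; g \<in> Hom B B'\<rbrakk>
      \<Longrightarrow> \<sigma> A' B' \<cdot> (f \<otimes>\<^sub>m g) = (g \<otimes>\<^sub>m f) \<cdot> \<sigma> A B"
    and Symmetry_involutive: "\<lbrakk>A \<in> Obj C; B \<in> Obj C\<rbrakk> \<Longrightarrow> \<sigma> B A \<cdot> \<sigma> A B = \<one> (A \<otimes> B)"
    and pentagon: "\<lbrakk>A \<in> Obj C; B \<in> Obj C; D \<in> Obj C; E \<in> Obj C\<rbrakk>
      \<Longrightarrow> \<alpha> A B (D \<otimes> E) \<cdot> \<alpha> (A \<otimes> B) D E =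
          (\<one> A \<otimes>\<^sub>m \<alpha> B D E) \<cdot> \<alpha> A (B \<otimes> D) E \<cdot> (\<alpha> A B D \<otimes>\<^sub>m \<one> E)"
    and triangle: "\<lbrakk>A \<in> Obj C; B \<in> Obj C\<rbrakk>
      \<Longrightarrow> (\<one> A \<otimes>\<^sub>m \<Lambda> B) \<cdot> \<alpha> A \<I> B = \<rho> A \<otimes>\<^sub>m \<one> B"
    and hexagon: "\<lbrakk>A \<in> Obj C; B \<in> Obj C; D \<in> Obj C\<rbrakk>
      \<Longrightarrow> \<alpha> B D A \<cdot> \<sigma> A (B \<otimes> D) \<cdot> \<alpha> A B D =
          (\<one> B \<otimes>\<^sub>m \<sigma> A D) \<cdot> \<alpha> B A D \<cdot> (\<sigma> A B \<otimes>\<^sub>m \<one> D)"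

text \<open>Partially defined expressions are options, with \<^const>\<open>None\<close> for undefined; Kleene equality
  is then equality of options.\<close>

definition kleene_le :: "'a option \<Rightarrow> 'a option \<Rightarrow> bool" (infix "\<lesssim>" 50) where
  "a \<lesssim> b \<longleftrightarrow> a = None \<or> a = b"

text \<open>\<open>Tr U X Y\<close> is the partial function on the morphisms from \<open>X \<otimes> U\<close> to \<open>Y \<otimes> U\<close>; its values
  on other arguments are irrelevant.  The associators make
  the bracketing in \<open>vanishing_II\<close> and \<open>superposing\<close> explicit.\<close>

locale partial_trace = symmetric_monoidal_category +
  fixes Tr :: "'a \<Rightarrow> 'a \<Rightarrow> 'a \<Rightarrow> 'b \<Rightarrow> 'b option"
  assumes Tr_Hom:
      "\<lbrakk>X \<in> Obj C; Y \<in> Obj C; U \<in> Obj C; f \<in> Hom (X \<otimes> U) (Y \<otimes> U); Tr U X Y f = Some t\<rbrakk>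
       \<Longrightarrow> t \<in> Hom X Y"
    and naturality:
      "\<lbrakk>X \<in> Obj C; Y \<in> Obj C; X' \<in> Obj C; Y' \<in> Obj C; U \<in> Obj C;
        f \<in> Hom (X \<otimes> U) (Y \<otimes> U); g \<in> Hom X' X; h \<in> Hom Y Y'\<rbrakk>
       \<Longrightarrow> map_option (\<lambda>t. h \<cdot> t \<cdot> g) (Tr U X Y f)
           \<lesssim> Tr U X' Y' ((h \<otimes>\<^sub>m \<one> U) \<cdot> f \<cdot> (g \<otimes>\<^sub>m \<one> U))"
    and dinaturality:
      "\<lbrakk>X \<in> Obj C; Y \<in> Obj C; U \<in> Obj C; U' \<in> Obj C;
        f \<in> Hom (X \<otimes> U) (Y \<otimes> U'); g \<in> Hom U' U\<rbrakk>
       \<Longrightarrow> Tr U X Y ((\<one> Y \<otimes>\<^sub>m g) \<cdot> f) = Tr U' X Y (f \<cdot> (\<one> X \<otimes>\<^sub>m g))"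
    and vanishing_I:
      "\<lbrakk>X \<in> Obj C; Y \<in> Obj C; f \<in> Hom (X \<otimes> \<I>) (Y \<otimes> \<I>)\<rbrakk>
       \<Longrightarrow> Tr \<I> X Y f = Some (\<rho> Y \<cdot> f \<cdot> Inv (\<rho> X))"
    and vanishing_II:
      "\<lbrakk>X \<in> Obj C; Y \<in> Obj C; U \<in> Obj C; V \<in> Obj C;
        g \<in> Hom ((X \<otimes> U) \<otimes> V) ((Y \<otimes> U) \<otimes> V); Tr V (X \<otimes> U) (Y \<otimes> U) g = Some t\<rbrakk>
       \<Longrightarrow> Tr (U \<otimes> V) X Y (\<alpha> Y U V \<cdot> g \<cdot> Inv (\<alpha> X U V)) = Tr U X Y t"
    and superposing:
      "\<lbrakk>X \<in> Obj C; Y \<in> Obj C; U \<in> Obj C; W \<in> Obj C; Z \<in> Obj C;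
        f \<in> Hom (X \<otimes> U) (Y \<otimes> U); g \<in> Hom W Z\<rbrakk>
       \<Longrightarrow> map_option (\<lambda>t. g \<otimes>\<^sub>m t) (Tr U X Y f)
           \<lesssim> Tr U (W \<otimes> X) (Z \<otimes> Y) (Inv (\<alpha> Z Y U) \<cdot> (g \<otimes>\<^sub>m f) \<cdot> \<alpha> W X U)"
    and yanking:
      "U \<in> Obj C \<Longrightarrow> Tr U U U (\<sigma> U U) = Some (\<one> U)"

text \<open>The objects of one category live in one type, which therefore has to contain a point and be
  closed under ordered pairs.  The atoms range over an arbitrary type, so every finite set of any
  type occurs as an object, via \<open>Atom\<close>.\<close>

datatype 'a elem = Atom 'a | Point | OPair (pfst: "'a elem") (psnd: "'a elem")

definition set_prod :: "'a elem set \<Rightarrow> 'a elem set \<Rightarrow> 'a elem set" where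
  "set_prod A B = {OPair a b | a b. a \<in> A \<and> b \<in> B}"

text \<open>\<open>mat f b a\<close> is the entry written \<open>f(b,a)\<close>.  Matrices are functions on the whole type that
  vanish off their index set, so that morphisms are equal iff their source, target and entries
  agree.\<close>

datatype 'a srel =
  Srel (src: "'a elem set") (tgt: "'a elem set") (mat: "'a elem \<Rightarrow> 'a elem \<Rightarrow> real")

definition srel_of :: "'a elem set \<Rightarrow> 'a elem set \<Rightarrow> ('a elem \<Rightarrow> 'a elem \<Rightarrow> real) \<Rightarrow> 'a srel" where
  "srel_of A B m = Srel A B (\<lambda>b a. if b \<in> B \<and> a \<in> A then m b a else 0)"

definition stochastic_rels :: "'a srel set" where
  "stochastic_rels = {f. finite (src f) \<and> finite (tgt f) \<and>
     (\<forall>b a. b \<notin> tgt f \<or> a \<notin> src f \<longrightarrow> mat f b a = 0) \<and>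
     (\<forall>b\<in>tgt f. \<forall>a\<in>src f. mat f b a \<in> {0..1}) \<and>
     (\<forall>a\<in>src f. (\<Sum>b\<in>tgt f. mat f b a) \<le> 1)}"

definition map_matrix :: "'a elem set \<Rightarrow> 'a elem set \<Rightarrow> ('a elem \<Rightarrow> 'a elem) \<Rightarrow> 'a srel" where
  "map_matrix A B \<phi> = srel_of A B (\<lambda>b a. if b = \<phi> a then 1 else 0)"

definition Srel_fn :: "('a elem set, 'a srel) monoidal_structure" where
  "Srel_fn = \<lparr>
     Obj = {A. finite A},
     Arr = stochastic_rels,
     Dom = src,
     Cod = tgt,
     Ident = (\<lambda>A. srel_of A A (\<lambda>b a. if b = a then 1 else 0)),
     Comp = (\<lambda>g f. srel_of (src f) (tgt g) (\<lambda>c a. \<Sum>b\<in>tgt f. mat g c b * mat f b a)),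
     TensorO = set_prod,
     TensorM = (\<lambda>f g. srel_of (set_prod (src f) (src g)) (set_prod (tgt f) (tgt g))
       (\<lambda>q p. mat f (pfst q) (pfst p) * mat g (psnd q) (psnd p))),
     UnitO = {Point},
     Assoc = (\<lambda>A B D. map_matrix (set_prod (set_prod A B) D) (set_prod A (set_prod B D))
       (\<lambda>p. OPair (pfst (pfst p)) (OPair (psnd (pfst p)) (psnd p)))),
     LeftUnitor = (\<lambda>A. map_matrix (set_prod {Point} A) A psnd),
     RightUnitor = (\<lambda>A. map_matrix (set_prod A {Point}) A pfst),
     Symmetry = (\<lambda>A B. map_matrix (set_prod A B) (set_prod B A) (\<lambda>p. OPair (psnd p) (pfst p)))\<rparr>"

definition srel_trace ::
  "'a elem set \<Rightarrow> 'a elem set \<Rightarrow> 'a elem set \<Rightarrow> 'a srel \<Rightarrow> 'a srel option" where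
  "srel_trace U X Y f =
     (if \<forall>x\<in>X. (\<Sum>y\<in>Y. \<Sum>u\<in>U. mat f (OPair y u) (OPair x u)) \<le> 1
      then Some (srel_of X Y (\<lambda>y x. \<Sum>u\<in>U. mat f (OPair y u) (OPair x u)))
      else None)"

end

theory Submission
  imports Defs
begin

text \<open>The formula is the partial trace of linear algebra, restricted to nonnegative matrices
  with column sums at most 1. Definedness is a genuine restriction: the sum at \<open>x\<close>
  draws on the columns \<open>OPair x u\<close> for all \<open>u\<close> in \<open>U\<close>, each
  bounded by 1, so it can be as large as the cardinality of \<open>U\<close>. The identity on
  \<open>set_prod {Point} U\<close> with a two-point \<open>U\<close> gives 2. The laws therefore
  split into two kinds. Naturality, vanishing I, superposing and yanking have to produce a defined
  trace; their expected value is already known to be a morphism, and its column bound is the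
  required inequality. Dinaturality and vanishing II only compare two traces: the tests on both
  sides are the same inequality, so nothing has to be shown about whether it holds.\<close>

text \<open>The structural isomorphisms are the matrices of functions, and composition and tensor of such
  matrices are computed on the functions; this reduces the coherence laws to identities between maps
  of tuples.  Whether a trace is defined, and which value it then has, is a matter of the diagonal
  sums over \<open>U\<close> alone, so each trace law reduces to an identity of finite sums.  Definedness is
  automatic whenever these sums are the entries of a morphism.\<close>

section \<open>Matrix entries\<close>

lemma OPair_in_set_prod [simp]: "OPair a b \<in> set_prod A B \<longleftrightarrow> a \<in> A \<and> b \<in> B"
  by (auto simp: set_prod_def)

lemma set_prodE:
  assumes "p \<in> set_prod A B"
  obtains a b where "p = OPair a b" "a \<in> A" "b \<in> B"
  using assms by (auto simp: set_prod_def)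

text \<open>Ties the encoded pairs to the product type, so that finiteness and iterated sums carry
  over along an injection.\<close>

lemma set_prod_image: "set_prod A B = (\<lambda>(a, b). OPair a b) ` (A \<times> B)"
  by (auto simp: set_prod_def)

lemma finite_set_prod [simp]: "finite A \<Longrightarrow> finite B \<Longrightarrow> finite (set_prod A B)"
  by (simp add: set_prod_image)

lemma sum_set_prod: "(\<Sum>p\<in>set_prod A B. h p) = (\<Sum>a\<in>A. \<Sum>b\<in>B. h (OPair a b))"
proof -
  have "inj_on (\<lambda>(a, b). OPair a b) (A \<times> B)"
    by (auto simp: inj_on_def)
  then show ?thesis
    by (simp add: set_prod_image sum.reindex sum.cartesian_product case_prod_unfold)
qed

lemma srel_of_simps [simp]:
  "src (srel_of A B m) = A"
  "tgt (srel_of A B m) = B"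
  "mat (srel_of A B m) b a = (if b \<in> B \<and> a \<in> A then m b a else 0)"
  by (simp_all add: srel_of_def)

lemma Srel_fn_simps [simp]:
  "Obj Srel_fn = {A. finite A}"
  "Arr Srel_fn = stochastic_rels"
  "Dom Srel_fn = src"
  "Cod Srel_fn = tgt"
  "TensorO Srel_fn = set_prod"
  "UnitO Srel_fn = {Point}"
  by (simp_all add: Srel_fn_def)

text \<open>A nonnegative entry is at most the sum of its column, so the entrywise bound
  \<open>{0..1}\<close> follows from the column bound.\<close>

lemma HomI:
  assumes "src f = A" "tgt f = B" "finite A" "finite B"
    and "\<And>b a. b \<notin> B \<or> a \<notin> A \<Longrightarrow> mat f b a = 0"
    and nonneg: "\<And>b a. b \<in> B \<Longrightarrow> a \<in> A \<Longrightarrow> 0 \<le> mat f b a"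
    and sum_le_1: "\<And>a. a \<in> A \<Longrightarrow> (\<Sum>b\<in>B. mat f b a) \<le> 1"
  shows "f \<in> Hom\<^bsub>Srel_fn\<^esub> A B"
proof -
  have "mat f b a \<le> 1" if "b \<in> B" "a \<in> A" for b a
    using member_le_sum[of b B "\<lambda>b. mat f b a"] that nonneg sum_le_1[of a] \<open>finite B\<close> by fastforce
  then show ?thesis
    using assms by (auto simp: Hom_def stochastic_rels_def)
qed

text \<open>Nonnegativity and the column bound come without membership conditions because matrices
  vanish off their index set; monotonicity arguments on sums can then cite them directly.\<close>

lemma HomD:
  assumes "f \<in> Hom\<^bsub>Srel_fn\<^esub> A B"
  shows "src f = A" "tgt f = B" "finite A" "finite B"
    and "b \<notin> B \<Longrightarrow> mat f b a = 0"
    and "a \<notin> A \<Longrightarrow> mat f b a = 0"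
    and "0 \<le> mat f b a"
    and "(\<Sum>b\<in>B. mat f b a) \<le> 1"
proof -
  show "src f = A" "tgt f = B" "finite A" "finite B"
    "b \<notin> B \<Longrightarrow> mat f b a = 0" "a \<notin> A \<Longrightarrow> mat f b a = 0"
    using assms by (auto simp: Hom_def stochastic_rels_def)
  show "0 \<le> mat f b a"
    using assms by (cases "b \<in> B \<and> a \<in> A") (auto simp: Hom_def stochastic_rels_def)
  show "(\<Sum>b\<in>B. mat f b a) \<le> 1"
    using assms by (cases "a \<in> A") (auto simp: Hom_def stochastic_rels_def)
qed

lemma Hom_eqI:
  assumes "f \<in> Hom\<^bsub>Srel_fn\<^esub> A B" "g \<in> Hom\<^bsub>Srel_fn\<^esub> A B"
    and "\<And>b a. b \<in> B \<Longrightarrow> a \<in> A \<Longrightarrow> mat f b a = mat g b a"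
  shows "f = g"
proof (rule srel.expand, intro conjI ext)
  show "mat f b a = mat g b a" for b a
    using assms HomD(5,6)[OF assms(1)] HomD(5,6)[OF assms(2)] by metis
qed (use assms in \<open>simp_all add: HomD\<close>)

lemma Comp_simps [simp]:
  "src (g \<cdot>\<^bsub>Srel_fn\<^esub> f) = src f" "tgt (g \<cdot>\<^bsub>Srel_fn\<^esub> f) = tgt g"
  by (simp_all add: Srel_fn_def)

text \<open>Valid at every \<open>d\<close> and \<open>a\<close>, since off the index sets both
  sides are zero. It thus rewrites under sums without side conditions on indices.\<close>

lemma mat_Comp:
  assumes "f \<in> Hom\<^bsub>Srel_fn\<^esub> A B" "g \<in> Hom\<^bsub>Srel_fn\<^esub> B D"
  shows "mat (g \<cdot>\<^bsub>Srel_fn\<^esub> f) d a = (\<Sum>b\<in>B. mat g d b * mat f b a)"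
  using HomD[OF assms(1)] HomD[OF assms(2)] by (auto simp: Srel_fn_def)

text \<open>A column sum of the product is a combination of column sums of \<open>g\<close>,
  weighted by a column of \<open>f\<close>; bounding the former by 1 leaves a column sum of
  \<open>f\<close>.\<close>

lemma Comp_in_Hom:
  assumes f: "f \<in> Hom\<^bsub>Srel_fn\<^esub> A B" and g: "g \<in> Hom\<^bsub>Srel_fn\<^esub> B D"
  shows "g \<cdot>\<^bsub>Srel_fn\<^esub> f \<in> Hom\<^bsub>Srel_fn\<^esub> A D"
proof (rule HomI)
  fix a
  have "(\<Sum>d\<in>D. mat (g \<cdot>\<^bsub>Srel_fn\<^esub> f) d a) = (\<Sum>b\<in>B. (\<Sum>d\<in>D. mat g d b) * mat f b a)"
    by (simp add: mat_Comp[OF f g] sum_distrib_right) (rule sum.swap)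
  also have "\<dots> \<le> (\<Sum>b\<in>B. 1 * mat f b a)"
    by (intro sum_mono mult_right_mono HomD(7)[OF f] HomD(8)[OF g])
  also have "\<dots> \<le> 1"
    using HomD(8)[OF f] by simp
  finally show "(\<Sum>d\<in>D. mat (g \<cdot>\<^bsub>Srel_fn\<^esub> f) d a) \<le> 1" .
qed (use HomD[OF f] HomD[OF g] in \<open>auto simp: mat_Comp[OF f g] intro!: sum_nonneg\<close>)

lemma TensorM_simps [simp]:
  "src (f \<otimes>\<^sub>m\<^bsub>Srel_fn\<^esub> g) = set_prod (src f) (src g)"
  "tgt (f \<otimes>\<^sub>m\<^bsub>Srel_fn\<^esub> g) = set_prod (tgt f) (tgt g)"
  by (simp_all add: Srel_fn_def)

lemma mat_TensorM:
  assumes "f \<in> Hom\<^bsub>Srel_fn\<^esub> A B" "g \<in> Hom\<^bsub>Srel_fn\<^esub> A' B'"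
  shows "mat (f \<otimes>\<^sub>m\<^bsub>Srel_fn\<^esub> g) (OPair b b') (OPair a a') = mat f b a * mat g b' a'"
  using HomD[OF assms(1)] HomD[OF assms(2)] by (auto simp: Srel_fn_def)

text \<open>Column sums of a tensor factor into a product of two numbers between 0 and 1.\<close>

lemma TensorM_in_Hom:
  assumes f: "f \<in> Hom\<^bsub>Srel_fn\<^esub> A B" and g: "g \<in> Hom\<^bsub>Srel_fn\<^esub> A' B'"
  shows "f \<otimes>\<^sub>m\<^bsub>Srel_fn\<^esub> g \<in> Hom\<^bsub>Srel_fn\<^esub> (set_prod A A') (set_prod B B')"
proof (rule HomI)
  fix p assume "p \<in> set_prod A A'"
  then obtain a a' where p: "p = OPair a a'"
    by (rule set_prodE)
  have "(\<Sum>q\<in>set_prod B B'. mat (f \<otimes>\<^sub>m\<^bsub>Srel_fn\<^esub> g) q p)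
      = (\<Sum>b\<in>B. mat f b a) * (\<Sum>b'\<in>B'. mat g b' a')"
    by (simp add: p sum_set_prod mat_TensorM[OF f g] sum_product)
  also have "\<dots> \<le> 1"
    by (intro mult_le_one sum_nonneg HomD(7,8)[OF f] HomD(7,8)[OF g])
  finally show "(\<Sum>q\<in>set_prod B B'. mat (f \<otimes>\<^sub>m\<^bsub>Srel_fn\<^esub> g) q p) \<le> 1" .
next
  fix q p assume "q \<in> set_prod B B'" "p \<in> set_prod A A'"
  then show "0 \<le> mat (f \<otimes>\<^sub>m\<^bsub>Srel_fn\<^esub> g) q p"
    using HomD(7)[OF f] HomD(7)[OF g] by (auto elim!: set_prodE simp: mat_TensorM[OF f g])
qed (use HomD[OF f] HomD[OF g] in \<open>auto simp: Srel_fn_def\<close>)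

section \<open>Matrices of functions\<close>

lemma map_matrix_simps [simp]:
  "src (map_matrix A B \<phi>) = A" "tgt (map_matrix A B \<phi>) = B"
  "mat (map_matrix A B \<phi>) b a = (if b \<in> B \<and> a \<in> A \<and> b = \<phi> a then 1 else 0)"
  by (auto simp: map_matrix_def)

text \<open>The coherence laws end here: \<open>pfst\<close> and \<open>psnd\<close> have a meaning
  only on pairs, so the two tuple maps can be compared only on the source set.\<close>

lemma map_matrix_cong:
  assumes "\<And>a. a \<in> A \<Longrightarrow> \<phi> a = \<psi> a"
  shows "map_matrix A B \<phi> = map_matrix A B \<psi>"
  using assms by (auto intro!: srel.expand ext)

text \<open>Column \<open>a\<close> contains a single 1 if \<open>\<phi> a\<close> lies in
  \<open>B\<close> and is zero otherwise; both are allowed, as columns need not sum to exactly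
  1.\<close>

lemma map_matrix_in_Hom:
  assumes "finite A" "finite B"
  shows "map_matrix A B \<phi> \<in> Hom\<^bsub>Srel_fn\<^esub> A B"
proof (rule HomI)
  fix a
  have "(\<Sum>b\<in>B. mat (map_matrix A B \<phi>) b a) \<le> (\<Sum>b\<in>B. if b = \<phi> a then 1 else 0)"
    by (intro sum_mono) simp
  also have "\<dots> \<le> 1"
    using assms by simp
  finally show "(\<Sum>b\<in>B. mat (map_matrix A B \<phi>) b a) \<le> 1" .
qed (use assms in auto)

lemma Ident_eq: "\<one>\<^bsub>Srel_fn\<^esub> A = map_matrix A A (\<lambda>a. a)"
  by (simp add: Srel_fn_def map_matrix_def)

lemma structural_eq:
  "\<alpha>\<^bsub>Srel_fn\<^esub> A B D = map_matrix (set_prod (set_prod A B) D) (set_prod A (set_prod B D))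
     (\<lambda>p. OPair (pfst (pfst p)) (OPair (psnd (pfst p)) (psnd p)))"
  "\<Lambda>\<^bsub>Srel_fn\<^esub> A = map_matrix (set_prod {Point} A) A psnd"
  "\<rho>\<^bsub>Srel_fn\<^esub> A = map_matrix (set_prod A {Point}) A pfst"
  "\<sigma>\<^bsub>Srel_fn\<^esub> A B = map_matrix (set_prod A B) (set_prod B A) (\<lambda>p. OPair (psnd p) (pfst p))"
  by (simp_all add: Srel_fn_def)

text \<open>Precomposing with a function relabels columns: column \<open>a\<close> of the function
  matrix has its only 1 in row \<open>\<phi> a\<close>, and the sum collapses to that term.\<close>

lemma mat_Comp_map_matrix:
  assumes f: "f \<in> Hom\<^bsub>Srel_fn\<^esub> B D" and "finite A" "a \<in> A" "\<phi> a \<in> B"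
  shows "mat (f \<cdot>\<^bsub>Srel_fn\<^esub> map_matrix A B \<phi>) d a = mat f d (\<phi> a)"
proof -
  have "mat (f \<cdot>\<^bsub>Srel_fn\<^esub> map_matrix A B \<phi>) d a = (\<Sum>b\<in>B. if b = \<phi> a then mat f d b else 0)"
    unfolding mat_Comp[OF map_matrix_in_Hom[OF \<open>finite A\<close> HomD(3)[OF f]] f]
    by (rule sum.cong) (use \<open>a \<in> A\<close> in auto)
  then show ?thesis
    using HomD(3)[OF f] \<open>\<phi> a \<in> B\<close> by simp
qed

text \<open>A row of a function matrix may contain several 1s, so postcomposing relabels rows only
  where the function is invertible. The last condition in \<open>inv\<close> says that
  \<open>\<psi> d\<close> is the sole preimage of \<open>d\<close>; for structural maps,
  \<open>\<psi>\<close> is the inverse bijection.\<close>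

lemma mat_map_matrix_Comp:
  assumes f: "f \<in> Hom\<^bsub>Srel_fn\<^esub> A B" and "finite D"
    and inv: "d \<in> D" "\<psi> d \<in> B" "\<And>b. b \<in> B \<Longrightarrow> d = \<phi> b \<longleftrightarrow> b = \<psi> d"
  shows "mat (map_matrix B D \<phi> \<cdot>\<^bsub>Srel_fn\<^esub> f) d a = mat f (\<psi> d) a"
proof -
  have "mat (map_matrix B D \<phi> \<cdot>\<^bsub>Srel_fn\<^esub> f) d a
      = (\<Sum>b\<in>B. if b = \<psi> d then mat f b a else 0)"
    unfolding mat_Comp[OF f map_matrix_in_Hom[OF HomD(4)[OF f] \<open>finite D\<close>]]
    by (rule sum.cong) (use inv in auto)
  then show ?thesis
    using HomD(4)[OF f] inv by simp
qed

text \<open>If \<open>\<phi>\<close> left \<open>B\<close> at some \<open>a\<close>, that column of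
  the composite would be zero although \<open>\<psi> (\<phi> a)\<close> might lie in
  \<open>D\<close>.\<close>

lemma map_matrix_Comp:
  assumes "finite A" "finite B" "finite D" "\<And>a. a \<in> A \<Longrightarrow> \<phi> a \<in> B"
  shows "map_matrix B D \<psi> \<cdot>\<^bsub>Srel_fn\<^esub> map_matrix A B \<phi> = map_matrix A D (\<lambda>a. \<psi> (\<phi> a))"
  using assms
  by (intro Hom_eqI[OF Comp_in_Hom[OF map_matrix_in_Hom map_matrix_in_Hom] map_matrix_in_Hom])
     (auto simp: mat_Comp_map_matrix[OF map_matrix_in_Hom])

lemma map_matrix_TensorM:
  assumes "finite A" "finite B" "finite A'" "finite B'"
  shows "map_matrix A B \<phi> \<otimes>\<^sub>m\<^bsub>Srel_fn\<^esub> map_matrix A' B' \<psi>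
    = map_matrix (set_prod A A') (set_prod B B') (\<lambda>p. OPair (\<phi> (pfst p)) (\<psi> (psnd p)))"
proof (rule Hom_eqI)
  show "map_matrix A B \<phi> \<otimes>\<^sub>m\<^bsub>Srel_fn\<^esub> map_matrix A' B' \<psi>
      \<in> Hom\<^bsub>Srel_fn\<^esub> (set_prod A A') (set_prod B B')"
    using assms by (intro TensorM_in_Hom map_matrix_in_Hom)
qed (use assms in \<open>auto simp: mat_TensorM[OF map_matrix_in_Hom map_matrix_in_Hom]
       intro!: map_matrix_in_Hom elim!: set_prodE split: if_splits\<close>)

section \<open>The category of finite stochastic relations\<close>

interpretation Srel_fn: category "Srel_fn :: ('a elem set, 'a srel) monoidal_structure"
proof
  fix f :: "'a srel" assume "f \<in> Arr Srel_fn"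
  then show "Dom Srel_fn f \<in> Obj Srel_fn" "Cod Srel_fn f \<in> Obj Srel_fn"
    by (auto simp: stochastic_rels_def)
next
  fix A :: "'a elem set" assume "A \<in> Obj Srel_fn"
  then show "\<one>\<^bsub>Srel_fn\<^esub> A \<in> Hom\<^bsub>Srel_fn\<^esub> A A"
    by (simp add: Ident_eq map_matrix_in_Hom)
next
  fix A B D :: "'a elem set" and f g
  assume "f \<in> Hom\<^bsub>Srel_fn\<^esub> A B" "g \<in> Hom\<^bsub>Srel_fn\<^esub> B D"
  then show "g \<cdot>\<^bsub>Srel_fn\<^esub> f \<in> Hom\<^bsub>Srel_fn\<^esub> A D"
    by (rule Comp_in_Hom)
next
  fix A B :: "'a elem set" and f
  assume f: "f \<in> Hom\<^bsub>Srel_fn\<^esub> A B"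
  note fin = HomD(3,4)[OF f]
  show "f \<cdot>\<^bsub>Srel_fn\<^esub> \<one>\<^bsub>Srel_fn\<^esub> A = f"
    unfolding Ident_eq using fin
    by (intro Hom_eqI[OF Comp_in_Hom[OF map_matrix_in_Hom f] f])
       (simp_all add: mat_Comp_map_matrix[OF f])
  show "\<one>\<^bsub>Srel_fn\<^esub> B \<cdot>\<^bsub>Srel_fn\<^esub> f = f"
    unfolding Ident_eq using fin
    by (intro Hom_eqI[OF Comp_in_Hom[OF f map_matrix_in_Hom] f])
       (auto simp: mat_map_matrix_Comp[OF f, where \<phi> = "\<lambda>b. b" and \<psi> = "\<lambda>b. b", OF _ _ _ eq_commute])
next
  fix A B D E :: "'a elem set" and f g h
  assume f: "f \<in> Hom\<^bsub>Srel_fn\<^esub> A B" and g: "g \<in> Hom\<^bsub>Srel_fn\<^esub> B D"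
    and h: "h \<in> Hom\<^bsub>Srel_fn\<^esub> D E"
  note gf = Comp_in_Hom[OF f g] and hg = Comp_in_Hom[OF g h]
  show "h \<cdot>\<^bsub>Srel_fn\<^esub> (g \<cdot>\<^bsub>Srel_fn\<^esub> f) = (h \<cdot>\<^bsub>Srel_fn\<^esub> g) \<cdot>\<^bsub>Srel_fn\<^esub> f"
  proof (rule Hom_eqI[OF Comp_in_Hom[OF gf h] Comp_in_Hom[OF f hg]])
    show "mat (h \<cdot>\<^bsub>Srel_fn\<^esub> (g \<cdot>\<^bsub>Srel_fn\<^esub> f)) e a
        = mat ((h \<cdot>\<^bsub>Srel_fn\<^esub> g) \<cdot>\<^bsub>Srel_fn\<^esub> f) e a" for e a
      by (simp add: mat_Comp[OF gf h] mat_Comp[OF f hg] mat_Comp[OF f g] mat_Comp[OF g h]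
          sum_distrib_left sum_distrib_right mult.assoc) (rule sum.swap)
  qed
qed

section \<open>Inverses of the structural isomorphisms\<close>

text \<open>\<open>Inv\<close> is a definite description, so it can be computed only once inverses
  are known to be unique: h = h(fg) = (hf)g = g.\<close>

lemma (in category) Inv_eqI:
  assumes f: "f \<in> Hom A B" and "is_inverse C f g"
  shows "Inv f = g"
proof -
  have *: "h \<in> Hom B A" "h \<cdot> f = \<one> A" "f \<cdot> h = \<one> B" if "is_inverse C f h" for h
    using f that by (auto simp: is_inverse_def Hom_def)
  have "h = g" if "is_inverse C f h" for h
  proof -
    have "h = h \<cdot> (f \<cdot> g)"
      using *[OF that] *[OF assms(2)] by (simp add: Comp_Id)
    also have "\<dots> = (h \<cdot> f) \<cdot> g"
      using *[OF that] *[OF assms(2)] f by (blast intro: Comp_assoc)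
    also have "\<dots> = g"
      using *[OF that] *[OF assms(2)] by (simp add: Id_Comp)
    finally show ?thesis .
  qed
  then show ?thesis
    unfolding Inv_def using assms(2) by blast
qed

lemma map_matrix_is_inverse:
  assumes "finite A" "finite B" "\<And>a. a \<in> A \<Longrightarrow> \<phi> a \<in> B \<and> \<psi> (\<phi> a) = a"
    and "\<And>b. b \<in> B \<Longrightarrow> \<psi> b \<in> A \<and> \<phi> (\<psi> b) = b"
  shows "is_inverse Srel_fn (map_matrix A B \<phi>) (map_matrix B A \<psi>)"
  using assms
  by (auto simp: is_inverse_def Ident_eq map_matrix_Comp map_matrix_in_Hom intro!: map_matrix_cong)

lemma Assoc_is_inverse:
  assumes "finite A" "finite B" "finite D"
  shows "is_inverse Srel_fn (\<alpha>\<^bsub>Srel_fn\<^esub> A B D)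
    (map_matrix (set_prod A (set_prod B D)) (set_prod (set_prod A B) D)
      (\<lambda>p. OPair (OPair (pfst p) (pfst (psnd p))) (psnd (psnd p))))"
  unfolding structural_eq by (rule map_matrix_is_inverse) (use assms in \<open>auto elim!: set_prodE\<close>)

lemma LeftUnitor_is_inverse:
  assumes "finite A"
  shows "is_inverse Srel_fn (\<Lambda>\<^bsub>Srel_fn\<^esub> A) (map_matrix A (set_prod {Point} A) (OPair Point))"
  unfolding structural_eq by (rule map_matrix_is_inverse) (use assms in \<open>auto elim!: set_prodE\<close>)

lemma RightUnitor_is_inverse:
  assumes "finite A"
  shows "is_inverse Srel_fn (\<rho>\<^bsub>Srel_fn\<^esub> A)
    (map_matrix A (set_prod A {Point}) (\<lambda>a. OPair a Point))"
  unfolding structural_eq by (rule map_matrix_is_inverse) (use assms in \<open>auto elim!: set_prodE\<close>)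

lemma structural_in_Hom:
  assumes "finite A" "finite B"
  shows "finite D \<Longrightarrow> \<alpha>\<^bsub>Srel_fn\<^esub> A B D
      \<in> Hom\<^bsub>Srel_fn\<^esub> (set_prod (set_prod A B) D) (set_prod A (set_prod B D))"
    and "\<Lambda>\<^bsub>Srel_fn\<^esub> A \<in> Hom\<^bsub>Srel_fn\<^esub> (set_prod {Point} A) A"
    and "\<rho>\<^bsub>Srel_fn\<^esub> A \<in> Hom\<^bsub>Srel_fn\<^esub> (set_prod A {Point}) A"
    and "\<sigma>\<^bsub>Srel_fn\<^esub> A B \<in> Hom\<^bsub>Srel_fn\<^esub> (set_prod A B) (set_prod B A)"
  using assms by (simp_all add: structural_eq map_matrix_in_Hom)

text \<open>Turns the inverse associators in vanishing II and superposing into function matrices,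
  whose composites can be read off entry by entry.\<close>

lemma Inv_Assoc:
  assumes "finite A" "finite B" "finite D"
  shows "Inv\<^bsub>Srel_fn\<^esub> (\<alpha>\<^bsub>Srel_fn\<^esub> A B D)
    = map_matrix (set_prod A (set_prod B D)) (set_prod (set_prod A B) D)
      (\<lambda>p. OPair (OPair (pfst p) (pfst (psnd p))) (psnd (psnd p)))"
  by (rule Srel_fn.Inv_eqI[OF structural_in_Hom(1) Assoc_is_inverse]) (use assms in simp_all)

lemma Inv_RightUnitor:
  assumes "finite A"
  shows "Inv\<^bsub>Srel_fn\<^esub> (\<rho>\<^bsub>Srel_fn\<^esub> A) = map_matrix A (set_prod A {Point}) (\<lambda>a. OPair a Point)"
  using assms by (intro Srel_fn.Inv_eqI[OF structural_in_Hom(3) RightUnitor_is_inverse])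

section \<open>The symmetric monoidal structure\<close>

interpretation Srel_fn:
  symmetric_monoidal_category "Srel_fn :: ('a elem set, 'a srel) monoidal_structure"
proof
  fix A B :: "'a elem set"
  assume "A \<in> Obj Srel_fn" "B \<in> Obj Srel_fn"
  then show "TensorO Srel_fn A B \<in> Obj Srel_fn"
    by simp
next
  show "UnitO Srel_fn \<in> Obj (Srel_fn :: ('a elem set, 'a srel) monoidal_structure)"
    by simp
next
  fix A B A' B' :: "'a elem set" and f g
  assume "f \<in> Hom\<^bsub>Srel_fn\<^esub> A B" "g \<in> Hom\<^bsub>Srel_fn\<^esub> A' B'"
  then show "f \<otimes>\<^sub>m\<^bsub>Srel_fn\<^esub> g \<in> Hom\<^bsub>Srel_fn\<^esub> (TensorO Srel_fn A A') (TensorO Srel_fn B B')"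
    by (simp add: TensorM_in_Hom)
next
  fix A B :: "'a elem set"
  assume "A \<in> Obj Srel_fn" "B \<in> Obj Srel_fn"
  then show "\<one>\<^bsub>Srel_fn\<^esub> A \<otimes>\<^sub>m\<^bsub>Srel_fn\<^esub> \<one>\<^bsub>Srel_fn\<^esub> B = \<one>\<^bsub>Srel_fn\<^esub> (TensorO Srel_fn A B)"
    by (auto simp: Ident_eq map_matrix_TensorM intro!: map_matrix_cong elim!: set_prodE)
next
  fix A B D A' B' D' :: "'a elem set" and f g f' g'
  assume f: "f \<in> Hom\<^bsub>Srel_fn\<^esub> A B" and g: "g \<in> Hom\<^bsub>Srel_fn\<^esub> B D"
    and f': "f' \<in> Hom\<^bsub>Srel_fn\<^esub> A' B'" and g': "g' \<in> Hom\<^bsub>Srel_fn\<^esub> B' D'"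
  note Homs = Comp_in_Hom[OF f g] Comp_in_Hom[OF f' g'] TensorM_in_Hom[OF f f'] TensorM_in_Hom[OF g g']
  show "(g \<cdot>\<^bsub>Srel_fn\<^esub> f) \<otimes>\<^sub>m\<^bsub>Srel_fn\<^esub> (g' \<cdot>\<^bsub>Srel_fn\<^esub> f')
      = (g \<otimes>\<^sub>m\<^bsub>Srel_fn\<^esub> g') \<cdot>\<^bsub>Srel_fn\<^esub> (f \<otimes>\<^sub>m\<^bsub>Srel_fn\<^esub> f')"
    \<comment> \<open>The entry on the left is a product of a sum over \<open>B\<close> and a sum
      over \<open>B'\<close>; distributing it gives the sum over \<open>set_prod B B'\<close> on the
      right.\<close>
    by (rule Hom_eqI[OF TensorM_in_Hom[OF Homs(1,2)] Comp_in_Hom[OF Homs(3,4)]])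
       (auto elim!: set_prodE simp: mat_TensorM[OF Homs(1,2)] mat_Comp[OF Homs(3,4)]
         mat_Comp[OF f g] mat_Comp[OF f' g'] mat_TensorM[OF f f'] mat_TensorM[OF g g']
         sum_set_prod sum_product mult_ac intro: sum.swap)
next
  fix A B D :: "'a elem set"
  assume "A \<in> Obj Srel_fn" "B \<in> Obj Srel_fn" "D \<in> Obj Srel_fn"
  then show "\<alpha>\<^bsub>Srel_fn\<^esub> A B D \<in> Isos\<^bsub>Srel_fn\<^esub> (TensorO Srel_fn (TensorO Srel_fn A B) D)
      (TensorO Srel_fn A (TensorO Srel_fn B D))"
    using Assoc_is_inverse[of A B D] by (auto simp: Isos_def structural_in_Hom)
next
  fix A B D A' B' D' :: "'a elem set" and f g h
  assume f: "f \<in> Hom\<^bsub>Srel_fn\<^esub> A A'" and g: "g \<in> Hom\<^bsub>Srel_fn\<^esub> B B'"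
    and h: "h \<in> Hom\<^bsub>Srel_fn\<^esub> D D'"
  note fin = HomD(3,4)[OF f] HomD(3,4)[OF g] HomD(3,4)[OF h]
  note fg = TensorM_in_Hom[OF f g] and gh = TensorM_in_Hom[OF g h]
  note fg_h = TensorM_in_Hom[OF fg h] and f_gh = TensorM_in_Hom[OF f gh]
  show "\<alpha>\<^bsub>Srel_fn\<^esub> A' B' D' \<cdot>\<^bsub>Srel_fn\<^esub> ((f \<otimes>\<^sub>m\<^bsub>Srel_fn\<^esub> g) \<otimes>\<^sub>m\<^bsub>Srel_fn\<^esub> h)
      = (f \<otimes>\<^sub>m\<^bsub>Srel_fn\<^esub> (g \<otimes>\<^sub>m\<^bsub>Srel_fn\<^esub> h)) \<cdot>\<^bsub>Srel_fn\<^esub> \<alpha>\<^bsub>Srel_fn\<^esub> A B D"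
  proof (rule Hom_eqI[OF Comp_in_Hom[OF fg_h structural_in_Hom(1)]
        Comp_in_Hom[OF structural_in_Hom(1) f_gh]])
    fix q p assume "q \<in> set_prod A' (set_prod B' D')" "p \<in> set_prod (set_prod A B) D"
    then show "mat (\<alpha>\<^bsub>Srel_fn\<^esub> A' B' D' \<cdot>\<^bsub>Srel_fn\<^esub> ((f \<otimes>\<^sub>m\<^bsub>Srel_fn\<^esub> g) \<otimes>\<^sub>m\<^bsub>Srel_fn\<^esub> h)) q p
      = mat ((f \<otimes>\<^sub>m\<^bsub>Srel_fn\<^esub> (g \<otimes>\<^sub>m\<^bsub>Srel_fn\<^esub> h)) \<cdot>\<^bsub>Srel_fn\<^esub> \<alpha>\<^bsub>Srel_fn\<^esub> A B D) q p"
      unfolding structural_eq using fin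
      \<comment> \<open>The witness \<open>\<psi>\<close> rebrackets in the direction opposite to
        the associator. Both entries become the same triple product, up to associativity of
        multiplication.\<close>
      by (subst mat_map_matrix_Comp[OF fg_h, where
            \<psi> = "\<lambda>p. OPair (OPair (pfst p) (pfst (psnd p))) (psnd (psnd p))"])
         (auto elim!: set_prodE simp: mat_Comp_map_matrix[OF f_gh] mat_TensorM[OF fg h]
           mat_TensorM[OF f gh] mat_TensorM[OF f g] mat_TensorM[OF g h])
  qed (use fin in auto)
next
  fix A :: "'a elem set"
  assume "A \<in> Obj Srel_fn"
  then show "\<Lambda>\<^bsub>Srel_fn\<^esub> A \<in> Isos\<^bsub>Srel_fn\<^esub> (TensorO Srel_fn (UnitO Srel_fn) A) A"
    "\<rho>\<^bsub>Srel_fn\<^esub> A \<in> Isos\<^bsub>Srel_fn\<^esub> (TensorO Srel_fn A (UnitO Srel_fn)) A"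
    using LeftUnitor_is_inverse[of A] RightUnitor_is_inverse[of A]
    by (auto simp: Isos_def structural_in_Hom)
next
  fix A B :: "'a elem set" and f
  assume f: "f \<in> Hom\<^bsub>Srel_fn\<^esub> A B"
  note fin = HomD(3,4)[OF f]
  have I: "\<one>\<^bsub>Srel_fn\<^esub> {Point} \<in> Hom\<^bsub>Srel_fn\<^esub> {Point} {Point}"
    by (simp add: Ident_eq map_matrix_in_Hom)
  note If = TensorM_in_Hom[OF I f] and fI = TensorM_in_Hom[OF f I]
  have "\<Lambda>\<^bsub>Srel_fn\<^esub> B \<cdot>\<^bsub>Srel_fn\<^esub> (\<one>\<^bsub>Srel_fn\<^esub> {Point} \<otimes>\<^sub>m\<^bsub>Srel_fn\<^esub> f) = f \<cdot>\<^bsub>Srel_fn\<^esub> \<Lambda>\<^bsub>Srel_fn\<^esub> A"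
  proof (rule Hom_eqI[OF Comp_in_Hom[OF If structural_in_Hom(2)]
        Comp_in_Hom[OF structural_in_Hom(2) f]])
    fix b p assume "b \<in> B" "p \<in> set_prod {Point} A"
    then show "mat (\<Lambda>\<^bsub>Srel_fn\<^esub> B \<cdot>\<^bsub>Srel_fn\<^esub> (\<one>\<^bsub>Srel_fn\<^esub> {Point} \<otimes>\<^sub>m\<^bsub>Srel_fn\<^esub> f)) b p
        = mat (f \<cdot>\<^bsub>Srel_fn\<^esub> \<Lambda>\<^bsub>Srel_fn\<^esub> A) b p"
      unfolding structural_eq using fin
      \<comment> \<open>\<open>I\<close> is unfolded inside \<open>mat_TensorM\<close> because the
        simplifier turns the identity into a \<open>map_matrix\<close> before that rule can
        match.\<close>
      by (subst mat_map_matrix_Comp[OF If, where \<psi> = "OPair Point"])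
         (auto elim!: set_prodE simp: mat_Comp_map_matrix[OF f] mat_TensorM[OF I[unfolded Ident_eq] f] Ident_eq)
  qed (use fin in auto)
  then show "\<Lambda>\<^bsub>Srel_fn\<^esub> B \<cdot>\<^bsub>Srel_fn\<^esub> (\<one>\<^bsub>Srel_fn\<^esub> (UnitO Srel_fn) \<otimes>\<^sub>m\<^bsub>Srel_fn\<^esub> f)
      = f \<cdot>\<^bsub>Srel_fn\<^esub> \<Lambda>\<^bsub>Srel_fn\<^esub> A"
    by simp
  have "\<rho>\<^bsub>Srel_fn\<^esub> B \<cdot>\<^bsub>Srel_fn\<^esub> (f \<otimes>\<^sub>m\<^bsub>Srel_fn\<^esub> \<one>\<^bsub>Srel_fn\<^esub> {Point}) = f \<cdot>\<^bsub>Srel_fn\<^esub> \<rho>\<^bsub>Srel_fn\<^esub> A"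
  proof (rule Hom_eqI[OF Comp_in_Hom[OF fI structural_in_Hom(3)]
        Comp_in_Hom[OF structural_in_Hom(3) f]])
    fix b p assume "b \<in> B" "p \<in> set_prod A {Point}"
    then show "mat (\<rho>\<^bsub>Srel_fn\<^esub> B \<cdot>\<^bsub>Srel_fn\<^esub> (f \<otimes>\<^sub>m\<^bsub>Srel_fn\<^esub> \<one>\<^bsub>Srel_fn\<^esub> {Point})) b p
        = mat (f \<cdot>\<^bsub>Srel_fn\<^esub> \<rho>\<^bsub>Srel_fn\<^esub> A) b p"
      unfolding structural_eq using fin
      by (subst mat_map_matrix_Comp[OF fI, where \<psi> = "\<lambda>b. OPair b Point"])
         (auto elim!: set_prodE simp: mat_Comp_map_matrix[OF f] mat_TensorM[OF f I[unfolded Ident_eq]] Ident_eq)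
  qed (use fin in auto)
  then show "\<rho>\<^bsub>Srel_fn\<^esub> B \<cdot>\<^bsub>Srel_fn\<^esub> (f \<otimes>\<^sub>m\<^bsub>Srel_fn\<^esub> \<one>\<^bsub>Srel_fn\<^esub> (UnitO Srel_fn))
      = f \<cdot>\<^bsub>Srel_fn\<^esub> \<rho>\<^bsub>Srel_fn\<^esub> A"
    by simp
next
  fix A B :: "'a elem set"
  assume "A \<in> Obj Srel_fn" "B \<in> Obj Srel_fn"
  then show "\<sigma>\<^bsub>Srel_fn\<^esub> A B \<in> Hom\<^bsub>Srel_fn\<^esub> (TensorO Srel_fn A B) (TensorO Srel_fn B A)"
    by (simp add: structural_in_Hom)
next
  fix A A' B B' :: "'a elem set" and f g
  assume f: "f \<in> Hom\<^bsub>Srel_fn\<^esub> A A'" and g: "g \<in> Hom\<^bsub>Srel_fn\<^esub> B B'"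
  note fin = HomD(3,4)[OF f] HomD(3,4)[OF g]
  note fg = TensorM_in_Hom[OF f g] and gf = TensorM_in_Hom[OF g f]
  show "\<sigma>\<^bsub>Srel_fn\<^esub> A' B' \<cdot>\<^bsub>Srel_fn\<^esub> (f \<otimes>\<^sub>m\<^bsub>Srel_fn\<^esub> g)
      = (g \<otimes>\<^sub>m\<^bsub>Srel_fn\<^esub> f) \<cdot>\<^bsub>Srel_fn\<^esub> \<sigma>\<^bsub>Srel_fn\<^esub> A B"
  proof (rule Hom_eqI[OF Comp_in_Hom[OF fg structural_in_Hom(4)]
        Comp_in_Hom[OF structural_in_Hom(4) gf]])
    fix q p assume "q \<in> set_prod B' A'" "p \<in> set_prod A B"
    then show "mat (\<sigma>\<^bsub>Srel_fn\<^esub> A' B' \<cdot>\<^bsub>Srel_fn\<^esub> (f \<otimes>\<^sub>m\<^bsub>Srel_fn\<^esub> g)) q p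
        = mat ((g \<otimes>\<^sub>m\<^bsub>Srel_fn\<^esub> f) \<cdot>\<^bsub>Srel_fn\<^esub> \<sigma>\<^bsub>Srel_fn\<^esub> A B) q p"
      unfolding structural_eq using fin
      by (subst mat_map_matrix_Comp[OF fg, where \<psi> = "\<lambda>p. OPair (psnd p) (pfst p)"])
         (auto elim!: set_prodE simp: mat_Comp_map_matrix[OF gf] mat_TensorM[OF f g]
           mat_TensorM[OF g f])
  qed (use fin in auto)
next
  fix A B :: "'a elem set"
  assume "A \<in> Obj Srel_fn" "B \<in> Obj Srel_fn"
  then show "\<sigma>\<^bsub>Srel_fn\<^esub> B A \<cdot>\<^bsub>Srel_fn\<^esub> \<sigma>\<^bsub>Srel_fn\<^esub> A B = \<one>\<^bsub>Srel_fn\<^esub> (TensorO Srel_fn A B)"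
    unfolding structural_eq Ident_eq Srel_fn_simps
    by (subst map_matrix_Comp) (auto elim!: set_prodE intro!: map_matrix_cong)
next
  fix A B D E :: "'a elem set"
  assume "A \<in> Obj Srel_fn" "B \<in> Obj Srel_fn" "D \<in> Obj Srel_fn" "E \<in> Obj Srel_fn"
  then have fin: "finite A" "finite B" "finite D" "finite E"
    by auto
  then show "\<alpha>\<^bsub>Srel_fn\<^esub> A B (TensorO Srel_fn D E) \<cdot>\<^bsub>Srel_fn\<^esub> \<alpha>\<^bsub>Srel_fn\<^esub> (TensorO Srel_fn A B) D E
      = (\<one>\<^bsub>Srel_fn\<^esub> A \<otimes>\<^sub>m\<^bsub>Srel_fn\<^esub> \<alpha>\<^bsub>Srel_fn\<^esub> B D E) \<cdot>\<^bsub>Srel_fn\<^esub>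
        \<alpha>\<^bsub>Srel_fn\<^esub> A (TensorO Srel_fn B D) E \<cdot>\<^bsub>Srel_fn\<^esub> (\<alpha>\<^bsub>Srel_fn\<^esub> A B D \<otimes>\<^sub>m\<^bsub>Srel_fn\<^esub> \<one>\<^bsub>Srel_fn\<^esub> E)"
    unfolding structural_eq Ident_eq Srel_fn_simps
    \<comment> \<open>Once the tensors are function matrices, each round of the repetition fuses one
      composition. With a single matrix left on each side, \<open>map_matrix_cong\<close> reduces
      the law to an identity on nested pairs.\<close>
    by (simp add: map_matrix_TensorM)
       (subst map_matrix_Comp, auto elim!: set_prodE intro!: map_matrix_cong)+
next
  fix A B :: "'a elem set"
  assume "A \<in> Obj Srel_fn" "B \<in> Obj Srel_fn"
  then show "(\<one>\<^bsub>Srel_fn\<^esub> A \<otimes>\<^sub>m\<^bsub>Srel_fn\<^esub> \<Lambda>\<^bsub>Srel_fn\<^esub> B) \<cdot>\<^bsub>Srel_fn\<^esub> \<alpha>\<^bsub>Srel_fn\<^esub> A (UnitO Srel_fn) B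
      = \<rho>\<^bsub>Srel_fn\<^esub> A \<otimes>\<^sub>m\<^bsub>Srel_fn\<^esub> \<one>\<^bsub>Srel_fn\<^esub> B"
    unfolding structural_eq Ident_eq Srel_fn_simps
    by (simp add: map_matrix_TensorM)
       (subst map_matrix_Comp, auto elim!: set_prodE intro!: map_matrix_cong)+
next
  fix A B D :: "'a elem set"
  assume "A \<in> Obj Srel_fn" "B \<in> Obj Srel_fn" "D \<in> Obj Srel_fn"
  then show "\<alpha>\<^bsub>Srel_fn\<^esub> B D A \<cdot>\<^bsub>Srel_fn\<^esub> \<sigma>\<^bsub>Srel_fn\<^esub> A (TensorO Srel_fn B D) \<cdot>\<^bsub>Srel_fn\<^esub>
        \<alpha>\<^bsub>Srel_fn\<^esub> A B D
      = (\<one>\<^bsub>Srel_fn\<^esub> B \<otimes>\<^sub>m\<^bsub>Srel_fn\<^esub> \<sigma>\<^bsub>Srel_fn\<^esub> A D) \<cdot>\<^bsub>Srel_fn\<^esub> \<alpha>\<^bsub>Srel_fn\<^esub> B A D \<cdot>\<^bsub>Srel_fn\<^esub>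
        (\<sigma>\<^bsub>Srel_fn\<^esub> A B \<otimes>\<^sub>m\<^bsub>Srel_fn\<^esub> \<one>\<^bsub>Srel_fn\<^esub> D)"
    unfolding structural_eq Ident_eq Srel_fn_simps
    by (simp add: map_matrix_TensorM)
       (subst map_matrix_Comp, auto elim!: set_prodE intro!: map_matrix_cong)+
qed

section \<open>The trace\<close>

text \<open>Allowing \<open>U\<close> and \<open>U'\<close> to differ is what dinaturality and
  vanishing II need, where the two sides trace out different objects.\<close>

lemma srel_trace_cong:
  assumes "\<And>x y. x \<in> X \<Longrightarrow> y \<in> Y \<Longrightarrow>
    (\<Sum>u\<in>U. mat f (OPair y u) (OPair x u)) = (\<Sum>u\<in>U'. mat g (OPair y u) (OPair x u))"
  shows "srel_trace U X Y f = srel_trace U' X Y g"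
  unfolding srel_trace_def srel_of_def using assms by (auto cong: if_cong sum.cong)

text \<open>Summed over \<open>y\<close>, the diagonal sums are the column sum of \<open>t\<close>
  at \<open>x\<close>, which \<open>HomD\<close> bounds by 1.\<close>

lemma srel_trace_SomeI:
  assumes t: "t \<in> Hom\<^bsub>Srel_fn\<^esub> X Y"
    and "\<And>x y. x \<in> X \<Longrightarrow> y \<in> Y \<Longrightarrow> (\<Sum>u\<in>U. mat f (OPair y u) (OPair x u)) = mat t y x"
  shows "srel_trace U X Y f = Some t"
proof -
  have "srel_of X Y (\<lambda>y x. \<Sum>u\<in>U. mat f (OPair y u) (OPair x u)) = t"
    using assms HomD(1,2,5,6)[OF t] by (intro srel.expand) (auto intro!: ext)
  then show ?thesis
    using assms(2) HomD(8)[OF t] by (auto simp: srel_trace_def)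
qed

text \<open>The definedness test supplies the column bound for \<open>t\<close>, and nonnegativity
  comes from \<open>f\<close>. The entry formula holds for all \<open>x\<close> and \<open>y\<close>
  because \<open>f\<close> vanishes off its index set.\<close>

lemma srel_trace_SomeD:
  assumes f: "f \<in> Hom\<^bsub>Srel_fn\<^esub> (set_prod X U) (set_prod Y U)" and "finite X" "finite Y"
    and t: "srel_trace U X Y f = Some t"
  shows "t \<in> Hom\<^bsub>Srel_fn\<^esub> X Y"
    and "mat t y x = (\<Sum>u\<in>U. mat f (OPair y u) (OPair x u))"
proof -
  have le: "\<forall>x\<in>X. (\<Sum>y\<in>Y. \<Sum>u\<in>U. mat f (OPair y u) (OPair x u)) \<le> 1"
    and t: "t = srel_of X Y (\<lambda>y x. \<Sum>u\<in>U. mat f (OPair y u) (OPair x u))"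
    using t by (auto simp: srel_trace_def split: if_splits)
  show "t \<in> Hom\<^bsub>Srel_fn\<^esub> X Y"
    by (rule HomI) (use assms HomD(7)[OF f] le in \<open>auto simp: t intro!: sum_nonneg\<close>)
  show "mat t y x = (\<Sum>u\<in>U. mat f (OPair y u) (OPair x u))"
    using HomD(5,6)[OF f] by (auto simp: t)
qed

text \<open>The identity factor is a Kronecker delta on \<open>U\<close>, so the sum over pairs
  collapses to one over \<open>Y\<close>. The three lemmas that follow treat the other positions of
  the identity: these first two serve naturality, the last two dinaturality.\<close>

lemma mat_tensor_Ident_Comp:
  assumes f: "f \<in> Hom\<^bsub>Srel_fn\<^esub> A (set_prod Y U)" and h: "h \<in> Hom\<^bsub>Srel_fn\<^esub> Y Y'"
    and "finite U" "u \<in> U"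
  shows "mat ((h \<otimes>\<^sub>m\<^bsub>Srel_fn\<^esub> \<one>\<^bsub>Srel_fn\<^esub> U) \<cdot>\<^bsub>Srel_fn\<^esub> f) (OPair y' u) a
    = (\<Sum>y\<in>Y. mat h y' y * mat f (OPair y u) a)"
proof -
  have I: "\<one>\<^bsub>Srel_fn\<^esub> U \<in> Hom\<^bsub>Srel_fn\<^esub> U U"
    using \<open>finite U\<close> by (simp add: Ident_eq map_matrix_in_Hom)
  have "mat ((h \<otimes>\<^sub>m\<^bsub>Srel_fn\<^esub> \<one>\<^bsub>Srel_fn\<^esub> U) \<cdot>\<^bsub>Srel_fn\<^esub> f) (OPair y' u) a
      = (\<Sum>y\<in>Y. \<Sum>v\<in>U. if v = u then mat h y' y * mat f (OPair y u) a else 0)"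
    unfolding mat_Comp[OF f TensorM_in_Hom[OF h I]] sum_set_prod mat_TensorM[OF h I]
    by (intro sum.cong) (use \<open>u \<in> U\<close> in \<open>auto simp: Ident_eq\<close>)
  then show ?thesis
    using assms by simp
qed

lemma mat_Comp_tensor_Ident:
  assumes f: "f \<in> Hom\<^bsub>Srel_fn\<^esub> (set_prod X U) B" and g: "g \<in> Hom\<^bsub>Srel_fn\<^esub> X' X"
    and "finite U" "u \<in> U"
  shows "mat (f \<cdot>\<^bsub>Srel_fn\<^esub> (g \<otimes>\<^sub>m\<^bsub>Srel_fn\<^esub> \<one>\<^bsub>Srel_fn\<^esub> U)) b (OPair x' u)
    = (\<Sum>x\<in>X. mat f b (OPair x u) * mat g x x')"
proof -
  have I: "\<one>\<^bsub>Srel_fn\<^esub> U \<in> Hom\<^bsub>Srel_fn\<^esub> U U"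
    using \<open>finite U\<close> by (simp add: Ident_eq map_matrix_in_Hom)
  have "mat (f \<cdot>\<^bsub>Srel_fn\<^esub> (g \<otimes>\<^sub>m\<^bsub>Srel_fn\<^esub> \<one>\<^bsub>Srel_fn\<^esub> U)) b (OPair x' u)
      = (\<Sum>x\<in>X. \<Sum>v\<in>U. if v = u then mat f b (OPair x u) * mat g x x' else 0)"
    unfolding mat_Comp[OF TensorM_in_Hom[OF g I] f] sum_set_prod mat_TensorM[OF g I]
    by (intro sum.cong) (use \<open>u \<in> U\<close> in \<open>auto simp: Ident_eq\<close>)
  then show ?thesis
    using assms by simp
qed

lemma mat_Ident_tensor_Comp:
  assumes f: "f \<in> Hom\<^bsub>Srel_fn\<^esub> A (set_prod Y U)" and g: "g \<in> Hom\<^bsub>Srel_fn\<^esub> U V"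
    and "finite Y" "y \<in> Y"
  shows "mat ((\<one>\<^bsub>Srel_fn\<^esub> Y \<otimes>\<^sub>m\<^bsub>Srel_fn\<^esub> g) \<cdot>\<^bsub>Srel_fn\<^esub> f) (OPair y v) a
    = (\<Sum>u\<in>U. mat g v u * mat f (OPair y u) a)"
proof -
  have I: "\<one>\<^bsub>Srel_fn\<^esub> Y \<in> Hom\<^bsub>Srel_fn\<^esub> Y Y"
    using \<open>finite Y\<close> by (simp add: Ident_eq map_matrix_in_Hom)
  have "mat ((\<one>\<^bsub>Srel_fn\<^esub> Y \<otimes>\<^sub>m\<^bsub>Srel_fn\<^esub> g) \<cdot>\<^bsub>Srel_fn\<^esub> f) (OPair y v) a
      = (\<Sum>u\<in>U. \<Sum>z\<in>Y. if z = y then mat g v u * mat f (OPair y u) a else 0)"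
    unfolding mat_Comp[OF f TensorM_in_Hom[OF I g]] sum_set_prod mat_TensorM[OF I g]
    \<comment> \<open>Here the delta sits on the outer index; the swap moves it inward, where the
      sum over it collapses.\<close>
    by (subst sum.swap, intro sum.cong) (use \<open>y \<in> Y\<close> in \<open>auto simp: Ident_eq\<close>)
  then show ?thesis
    using assms by simp
qed

lemma mat_Comp_Ident_tensor:
  assumes f: "f \<in> Hom\<^bsub>Srel_fn\<^esub> (set_prod X V) B" and g: "g \<in> Hom\<^bsub>Srel_fn\<^esub> U V"
    and "finite X" "x \<in> X"
  shows "mat (f \<cdot>\<^bsub>Srel_fn\<^esub> (\<one>\<^bsub>Srel_fn\<^esub> X \<otimes>\<^sub>m\<^bsub>Srel_fn\<^esub> g)) b (OPair x u)
    = (\<Sum>v\<in>V. mat f b (OPair x v) * mat g v u)"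
proof -
  have I: "\<one>\<^bsub>Srel_fn\<^esub> X \<in> Hom\<^bsub>Srel_fn\<^esub> X X"
    using \<open>finite X\<close> by (simp add: Ident_eq map_matrix_in_Hom)
  have "mat (f \<cdot>\<^bsub>Srel_fn\<^esub> (\<one>\<^bsub>Srel_fn\<^esub> X \<otimes>\<^sub>m\<^bsub>Srel_fn\<^esub> g)) b (OPair x u)
      = (\<Sum>v\<in>V. \<Sum>z\<in>X. if z = x then mat f b (OPair x v) * mat g v u else 0)"
    unfolding mat_Comp[OF TensorM_in_Hom[OF I g] f] sum_set_prod mat_TensorM[OF I g]
    by (subst sum.swap, intro sum.cong) (use \<open>x \<in> X\<close> in \<open>auto simp: Ident_eq\<close>)
  then show ?thesis
    using assms by simp
qed

section \<open>The laws of the trace\<close>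

text \<open>Multiplication by \<open>h\<close> and \<open>g\<close> involves only the indices in
  \<open>Y\<close> and \<open>X\<close>, so the sum over \<open>U\<close> commutes with it.\<close>

lemma srel_trace_natural:
  assumes f: "f \<in> Hom\<^bsub>Srel_fn\<^esub> (set_prod X U) (set_prod Y U)"
    and g: "g \<in> Hom\<^bsub>Srel_fn\<^esub> X' X" and h: "h \<in> Hom\<^bsub>Srel_fn\<^esub> Y Y'"
    and "finite U" and Some: "srel_trace U X Y f = Some t"
  shows "srel_trace U X' Y' ((h \<otimes>\<^sub>m\<^bsub>Srel_fn\<^esub> \<one>\<^bsub>Srel_fn\<^esub> U) \<cdot>\<^bsub>Srel_fn\<^esub> f \<cdot>\<^bsub>Srel_fn\<^esub>
      (g \<otimes>\<^sub>m\<^bsub>Srel_fn\<^esub> \<one>\<^bsub>Srel_fn\<^esub> U))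
    = Some (h \<cdot>\<^bsub>Srel_fn\<^esub> t \<cdot>\<^bsub>Srel_fn\<^esub> g)"
proof (rule srel_trace_SomeI)
  note t = srel_trace_SomeD[OF f HomD(4)[OF g] HomD(3)[OF h] Some]
  note tg = Comp_in_Hom[OF g t(1)]
  show "h \<cdot>\<^bsub>Srel_fn\<^esub> t \<cdot>\<^bsub>Srel_fn\<^esub> g \<in> Hom\<^bsub>Srel_fn\<^esub> X' Y'"
    by (rule Comp_in_Hom[OF tg h])
  have I: "\<one>\<^bsub>Srel_fn\<^esub> U \<in> Hom\<^bsub>Srel_fn\<^esub> U U"
    using \<open>finite U\<close> by (simp add: Ident_eq map_matrix_in_Hom)
  note fg = Comp_in_Hom[OF TensorM_in_Hom[OF g I] f]
  fix x y
  have "(\<Sum>u\<in>U. mat ((h \<otimes>\<^sub>m\<^bsub>Srel_fn\<^esub> \<one>\<^bsub>Srel_fn\<^esub> U) \<cdot>\<^bsub>Srel_fn\<^esub> f \<cdot>\<^bsub>Srel_fn\<^esub>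
          (g \<otimes>\<^sub>m\<^bsub>Srel_fn\<^esub> \<one>\<^bsub>Srel_fn\<^esub> U)) (OPair y u) (OPair x u))
      = (\<Sum>u\<in>U. \<Sum>y'\<in>Y. \<Sum>x'\<in>X. mat h y y' * (mat f (OPair y' u) (OPair x' u) * mat g x' x))"
    by (intro sum.cong refl)
       (simp add: mat_tensor_Ident_Comp[OF fg h \<open>finite U\<close>] mat_Comp_tensor_Ident[OF f g \<open>finite U\<close>]
         sum_distrib_left)
  also have "\<dots> = (\<Sum>y'\<in>Y. \<Sum>x'\<in>X. \<Sum>u\<in>U. mat h y y' * (mat f (OPair y' u) (OPair x' u) * mat g x' x))"
    \<comment> \<open>Two swaps carry the sum over \<open>U\<close> past \<open>Y\<close> and then
      past \<open>X\<close>, to where it forms the entries of \<open>t\<close>.\<close>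
    by (subst sum.swap, intro sum.cong refl sum.swap)
  also have "\<dots> = mat (h \<cdot>\<^bsub>Srel_fn\<^esub> t \<cdot>\<^bsub>Srel_fn\<^esub> g) y x"
    by (simp add: mat_Comp[OF tg h] mat_Comp[OF g t(1)] t(2) sum_distrib_left sum_distrib_right)
  finally show "(\<Sum>u\<in>U. mat ((h \<otimes>\<^sub>m\<^bsub>Srel_fn\<^esub> \<one>\<^bsub>Srel_fn\<^esub> U) \<cdot>\<^bsub>Srel_fn\<^esub> f \<cdot>\<^bsub>Srel_fn\<^esub>
          (g \<otimes>\<^sub>m\<^bsub>Srel_fn\<^esub> \<one>\<^bsub>Srel_fn\<^esub> U)) (OPair y u) (OPair x u))
      = mat (h \<cdot>\<^bsub>Srel_fn\<^esub> t \<cdot>\<^bsub>Srel_fn\<^esub> g) y x" .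
qed

text \<open>For fixed \<open>x\<close> and \<open>y\<close> this is the identity tr(AB) = tr(BA):
  the same double sum over \<open>U\<close> and \<open>U'\<close>, taken in either order.\<close>

lemma srel_trace_dinatural:
  assumes f: "f \<in> Hom\<^bsub>Srel_fn\<^esub> (set_prod X U) (set_prod Y U')"
    and g: "g \<in> Hom\<^bsub>Srel_fn\<^esub> U' U" and "finite X" "finite Y"
  shows "srel_trace U X Y ((\<one>\<^bsub>Srel_fn\<^esub> Y \<otimes>\<^sub>m\<^bsub>Srel_fn\<^esub> g) \<cdot>\<^bsub>Srel_fn\<^esub> f)
    = srel_trace U' X Y (f \<cdot>\<^bsub>Srel_fn\<^esub> (\<one>\<^bsub>Srel_fn\<^esub> X \<otimes>\<^sub>m\<^bsub>Srel_fn\<^esub> g))"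
proof (rule srel_trace_cong)
  fix x y assume "x \<in> X" "y \<in> Y"
  then show "(\<Sum>u\<in>U. mat ((\<one>\<^bsub>Srel_fn\<^esub> Y \<otimes>\<^sub>m\<^bsub>Srel_fn\<^esub> g) \<cdot>\<^bsub>Srel_fn\<^esub> f) (OPair y u) (OPair x u))
      = (\<Sum>u\<in>U'. mat (f \<cdot>\<^bsub>Srel_fn\<^esub> (\<one>\<^bsub>Srel_fn\<^esub> X \<otimes>\<^sub>m\<^bsub>Srel_fn\<^esub> g)) (OPair y u) (OPair x u))"
    using assms
    by (simp add: mat_Ident_tensor_Comp[OF f g] mat_Comp_Ident_tensor[OF f g] mult.commute)
       (rule sum.swap)
qed

text \<open>Over a one-point object there is a single diagonal term, and the unitors merely drop the
  point from the labels; the trace is \<open>f\<close> itself, relabelled.\<close>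

lemma srel_trace_vanishing_I:
  assumes f: "f \<in> Hom\<^bsub>Srel_fn\<^esub> (set_prod X {Point}) (set_prod Y {Point})"
    and fin: "finite X" "finite Y"
  shows "srel_trace {Point} X Y f
    = Some (\<rho>\<^bsub>Srel_fn\<^esub> Y \<cdot>\<^bsub>Srel_fn\<^esub> f \<cdot>\<^bsub>Srel_fn\<^esub> Inv\<^bsub>Srel_fn\<^esub> (\<rho>\<^bsub>Srel_fn\<^esub> X))"
proof (rule srel_trace_SomeI)
  have f': "f \<cdot>\<^bsub>Srel_fn\<^esub> Inv\<^bsub>Srel_fn\<^esub> (\<rho>\<^bsub>Srel_fn\<^esub> X) \<in> Hom\<^bsub>Srel_fn\<^esub> X (set_prod Y {Point})"
    by (rule Comp_in_Hom[OF _ f]) (simp add: fin Inv_RightUnitor map_matrix_in_Hom)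
  show "\<rho>\<^bsub>Srel_fn\<^esub> Y \<cdot>\<^bsub>Srel_fn\<^esub> f \<cdot>\<^bsub>Srel_fn\<^esub> Inv\<^bsub>Srel_fn\<^esub> (\<rho>\<^bsub>Srel_fn\<^esub> X) \<in> Hom\<^bsub>Srel_fn\<^esub> X Y"
    using fin by (intro Comp_in_Hom[OF f'] structural_in_Hom)
  fix x y assume "x \<in> X" "y \<in> Y"
  then have "mat (\<rho>\<^bsub>Srel_fn\<^esub> Y \<cdot>\<^bsub>Srel_fn\<^esub> f \<cdot>\<^bsub>Srel_fn\<^esub> Inv\<^bsub>Srel_fn\<^esub> (\<rho>\<^bsub>Srel_fn\<^esub> X)) y x
      = mat (f \<cdot>\<^bsub>Srel_fn\<^esub> Inv\<^bsub>Srel_fn\<^esub> (\<rho>\<^bsub>Srel_fn\<^esub> X)) (OPair y Point) x"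
    unfolding structural_eq(3)[of Y] using fin
    by (intro mat_map_matrix_Comp[OF f', where \<psi> = "\<lambda>b. OPair b Point"]) (auto elim!: set_prodE)
  also have "\<dots> = mat f (OPair y Point) (OPair x Point)"
    using fin \<open>x \<in> X\<close> by (simp add: Inv_RightUnitor mat_Comp_map_matrix[OF f])
  finally show "(\<Sum>u\<in>{Point}. mat f (OPair y u) (OPair x u))
      = mat (\<rho>\<^bsub>Srel_fn\<^esub> Y \<cdot>\<^bsub>Srel_fn\<^esub> f \<cdot>\<^bsub>Srel_fn\<^esub> Inv\<^bsub>Srel_fn\<^esub> (\<rho>\<^bsub>Srel_fn\<^esub> X)) y x"
    by simp
qed

text \<open>A sum over \<open>set_prod U V\<close> is an iterated sum whose inner part is an entry
  of \<open>t\<close>. Definedness of the inner trace is a proper condition: its test also counts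
  entries with different \<open>U\<close>-components in row and column, which the trace over
  \<open>set_prod U V\<close> never sees.\<close>

lemma srel_trace_vanishing_II:
  assumes g: "g \<in> Hom\<^bsub>Srel_fn\<^esub> (set_prod (set_prod X U) V) (set_prod (set_prod Y U) V)"
    and fin: "finite X" "finite Y" "finite U" "finite V"
    and Some: "srel_trace V (set_prod X U) (set_prod Y U) g = Some t"
  shows "srel_trace (set_prod U V) X Y
      (\<alpha>\<^bsub>Srel_fn\<^esub> Y U V \<cdot>\<^bsub>Srel_fn\<^esub> g \<cdot>\<^bsub>Srel_fn\<^esub> Inv\<^bsub>Srel_fn\<^esub> (\<alpha>\<^bsub>Srel_fn\<^esub> X U V))
    = srel_trace U X Y t"
proof (rule srel_trace_cong)
  note t = srel_trace_SomeD[OF g _ _ Some]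
  let ?g' = "g \<cdot>\<^bsub>Srel_fn\<^esub> Inv\<^bsub>Srel_fn\<^esub> (\<alpha>\<^bsub>Srel_fn\<^esub> X U V)"
  have g': "?g' \<in> Hom\<^bsub>Srel_fn\<^esub> (set_prod X (set_prod U V)) (set_prod (set_prod Y U) V)"
    by (rule Comp_in_Hom[OF _ g]) (simp add: fin Inv_Assoc map_matrix_in_Hom)
  fix x y assume xy: "x \<in> X" "y \<in> Y"
  have "mat (\<alpha>\<^bsub>Srel_fn\<^esub> Y U V \<cdot>\<^bsub>Srel_fn\<^esub> ?g') (OPair y (OPair u v)) (OPair x (OPair u v))
      = mat g (OPair (OPair y u) v) (OPair (OPair x u) v)" if "u \<in> U" "v \<in> V" for u v
  proof -
    have "mat (\<alpha>\<^bsub>Srel_fn\<^esub> Y U V \<cdot>\<^bsub>Srel_fn\<^esub> ?g') (OPair y (OPair u v)) (OPair x (OPair u v))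
        = mat ?g' (OPair (OPair y u) v) (OPair x (OPair u v))"
      unfolding structural_eq(1)[of Y] using fin xy that
      by (subst mat_map_matrix_Comp[OF g', where
            \<psi> = "\<lambda>p. OPair (OPair (pfst p) (pfst (psnd p))) (psnd (psnd p))"])
         (auto elim!: set_prodE)
    then show ?thesis
      using fin xy that by (simp add: Inv_Assoc mat_Comp_map_matrix[OF g])
  qed
  then show "(\<Sum>p\<in>set_prod U V. mat (\<alpha>\<^bsub>Srel_fn\<^esub> Y U V \<cdot>\<^bsub>Srel_fn\<^esub> ?g') (OPair y p) (OPair x p))
      = (\<Sum>u\<in>U. mat t (OPair y u) (OPair x u))"
    using fin by (simp add: sum_set_prod t(2))
qed

text \<open>The factor \<open>mat g z w\<close> does not depend on \<open>u\<close> and leaves the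
  sum. The converse direction fails: for a zero matrix \<open>g\<close> the trace of the tensor is
  always defined, whatever \<open>f\<close> is.\<close>

lemma srel_trace_superposing:
  assumes f: "f \<in> Hom\<^bsub>Srel_fn\<^esub> (set_prod X U) (set_prod Y U)"
    and g: "g \<in> Hom\<^bsub>Srel_fn\<^esub> W Z" and fin: "finite X" "finite Y" "finite U"
    and Some: "srel_trace U X Y f = Some t"
  shows "srel_trace U (set_prod W X) (set_prod Z Y)
      (Inv\<^bsub>Srel_fn\<^esub> (\<alpha>\<^bsub>Srel_fn\<^esub> Z Y U) \<cdot>\<^bsub>Srel_fn\<^esub> (g \<otimes>\<^sub>m\<^bsub>Srel_fn\<^esub> f) \<cdot>\<^bsub>Srel_fn\<^esub> \<alpha>\<^bsub>Srel_fn\<^esub> W X U)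
    = Some (g \<otimes>\<^sub>m\<^bsub>Srel_fn\<^esub> t)"
proof (rule srel_trace_SomeI)
  note t = srel_trace_SomeD[OF f fin(1,2) Some]
  show "g \<otimes>\<^sub>m\<^bsub>Srel_fn\<^esub> t \<in> Hom\<^bsub>Srel_fn\<^esub> (set_prod W X) (set_prod Z Y)"
    by (rule TensorM_in_Hom[OF g t(1)])
  note fin = fin HomD(3,4)[OF g] and gf = TensorM_in_Hom[OF g f]
  let ?k = "(g \<otimes>\<^sub>m\<^bsub>Srel_fn\<^esub> f) \<cdot>\<^bsub>Srel_fn\<^esub> \<alpha>\<^bsub>Srel_fn\<^esub> W X U"
  have k: "?k \<in> Hom\<^bsub>Srel_fn\<^esub> (set_prod (set_prod W X) U) (set_prod Z (set_prod Y U))"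
    using fin by (intro Comp_in_Hom[OF _ gf] structural_in_Hom)
  fix p q assume "p \<in> set_prod W X" "q \<in> set_prod Z Y"
  then obtain w x z y where pq: "p = OPair w x" "q = OPair z y"
    and in_sets: "w \<in> W" "x \<in> X" "z \<in> Z" "y \<in> Y"
    by (auto elim!: set_prodE)
  have "mat (Inv\<^bsub>Srel_fn\<^esub> (\<alpha>\<^bsub>Srel_fn\<^esub> Z Y U) \<cdot>\<^bsub>Srel_fn\<^esub> ?k) (OPair q u) (OPair p u)
      = mat g z w * mat f (OPair y u) (OPair x u)" if "u \<in> U" for u
  proof -
    have "mat (Inv\<^bsub>Srel_fn\<^esub> (\<alpha>\<^bsub>Srel_fn\<^esub> Z Y U) \<cdot>\<^bsub>Srel_fn\<^esub> ?k) (OPair q u) (OPair p u)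
        = mat ?k (OPair z (OPair y u)) (OPair p u)"
      \<comment> \<open>The extended list \<open>fin\<close> runs through \<open>X\<close>,
        \<open>Y\<close>, \<open>U\<close>, \<open>W\<close>, \<open>Z\<close>. As the outer map is
        an inverse associator, the witness \<open>\<psi>\<close> is the associator's own
        bijection.\<close>
      unfolding Inv_Assoc[OF fin(5,2,3)] using fin in_sets that
      by (subst mat_map_matrix_Comp[OF k, where
            \<psi> = "\<lambda>p. OPair (pfst (pfst p)) (OPair (psnd (pfst p)) (psnd p))"])
         (auto elim!: set_prodE simp: pq)
    then show ?thesis
      using fin in_sets that
      by (simp add: structural_eq mat_Comp_map_matrix[OF gf] mat_TensorM[OF g f] pq)
  qed
  then show "(\<Sum>u\<in>U. mat (Inv\<^bsub>Srel_fn\<^esub> (\<alpha>\<^bsub>Srel_fn\<^esub> Z Y U) \<cdot>\<^bsub>Srel_fn\<^esub> ?k) (OPair q u) (OPair p u))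
      = mat (g \<otimes>\<^sub>m\<^bsub>Srel_fn\<^esub> t) q p"
    by (simp add: pq mat_TensorM[OF g t(1)] t(2) sum_distrib_left)
qed

text \<open>The entry at \<open>OPair y u\<close> and \<open>OPair x u\<close> is 1 only if
  \<open>y = u\<close> and \<open>u = x\<close>, so the single term \<open>u = y\<close> survives
  and gives the identity matrix.\<close>

lemma srel_trace_yanking:
  assumes "finite U"
  shows "srel_trace U U U (\<sigma>\<^bsub>Srel_fn\<^esub> U U) = Some (\<one>\<^bsub>Srel_fn\<^esub> U)"
proof (rule srel_trace_SomeI)
  fix x y assume "x \<in> U" "y \<in> U"
  then have "(\<Sum>u\<in>U. mat (\<sigma>\<^bsub>Srel_fn\<^esub> U U) (OPair y u) (OPair x u))
      = (\<Sum>u\<in>U. if u = y then if y = x then 1 else 0 else 0)"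
    by (intro sum.cong) (auto simp: structural_eq)
  then show "(\<Sum>u\<in>U. mat (\<sigma>\<^bsub>Srel_fn\<^esub> U U) (OPair y u) (OPair x u)) = mat (\<one>\<^bsub>Srel_fn\<^esub> U) y x"
    using assms \<open>x \<in> U\<close> \<open>y \<in> U\<close> by (simp add: Ident_eq)
qed (use assms in \<open>simp add: Ident_eq map_matrix_in_Hom\<close>)

theorem proposition4p2p6:
  "partial_trace (Srel_fn :: ('a elem set, 'a srel) monoidal_structure) srel_trace"
proof
  fix X Y U :: "'a elem set" and f t
  assume "X \<in> Obj Srel_fn" "Y \<in> Obj Srel_fn"
    "f \<in> Hom\<^bsub>Srel_fn\<^esub> (TensorO Srel_fn X U) (TensorO Srel_fn Y U)" "srel_trace U X Y f = Some t"
  then show "t \<in> Hom\<^bsub>Srel_fn\<^esub> X Y"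
    using srel_trace_SomeD(1) by simp
next
  fix X Y X' Y' U :: "'a elem set" and f g h
  assume "U \<in> Obj Srel_fn" "f \<in> Hom\<^bsub>Srel_fn\<^esub> (TensorO Srel_fn X U) (TensorO Srel_fn Y U)"
    "g \<in> Hom\<^bsub>Srel_fn\<^esub> X' X" "h \<in> Hom\<^bsub>Srel_fn\<^esub> Y Y'"
  then show "map_option (\<lambda>t. h \<cdot>\<^bsub>Srel_fn\<^esub> t \<cdot>\<^bsub>Srel_fn\<^esub> g) (srel_trace U X Y f)
      \<lesssim> srel_trace U X' Y' ((h \<otimes>\<^sub>m\<^bsub>Srel_fn\<^esub> \<one>\<^bsub>Srel_fn\<^esub> U) \<cdot>\<^bsub>Srel_fn\<^esub> f \<cdot>\<^bsub>Srel_fn\<^esub>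
        (g \<otimes>\<^sub>m\<^bsub>Srel_fn\<^esub> \<one>\<^bsub>Srel_fn\<^esub> U))"
    \<comment> \<open>An undefined left side satisfies \<open>\<lesssim>\<close> trivially; the law
      is used only in the defined case.\<close>
    by (cases "srel_trace U X Y f") (simp_all add: kleene_le_def srel_trace_natural)
next
  fix X Y U W Z :: "'a elem set" and f g
  assume "X \<in> Obj Srel_fn" "Y \<in> Obj Srel_fn" "U \<in> Obj Srel_fn"
    "f \<in> Hom\<^bsub>Srel_fn\<^esub> (TensorO Srel_fn X U) (TensorO Srel_fn Y U)" "g \<in> Hom\<^bsub>Srel_fn\<^esub> W Z"
  then show "map_option (\<lambda>t. g \<otimes>\<^sub>m\<^bsub>Srel_fn\<^esub> t) (srel_trace U X Y f)
      \<lesssim> srel_trace U (TensorO Srel_fn W X) (TensorO Srel_fn Z Y)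
        (Inv\<^bsub>Srel_fn\<^esub> (\<alpha>\<^bsub>Srel_fn\<^esub> Z Y U) \<cdot>\<^bsub>Srel_fn\<^esub> (g \<otimes>\<^sub>m\<^bsub>Srel_fn\<^esub> f) \<cdot>\<^bsub>Srel_fn\<^esub> \<alpha>\<^bsub>Srel_fn\<^esub> W X U)"
    by (cases "srel_trace U X Y f") (simp_all add: kleene_le_def srel_trace_superposing)
qed (simp_all add: srel_trace_dinatural srel_trace_vanishing_I srel_trace_vanishing_II
    srel_trace_yanking)

end
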